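(* Let $\boldsymbol w\in\{0,1\}^\omega$ be a faux-bonacci $\omega$-word. Then $\boldsymbol w=a\varphi(\boldsymbol u)$ for some faux-bonacci $\omega$-word $\boldsymbol u\in\{0,1\}^\omega$ and some $a\in\{\epsilon,1\}$.
   Context: Words are over the binary alphabet $\{0,1\}$; an $\omega$-word is an infinite word $w_1w_2w_3\cdots$ indexed by the positive integers. $\varphi$ is the Fibonacci morphism $\varphi(0)=01$, $\varphi(1)=0$. For a non-empty word $X$, $X^-$ denotes $X$ with its last letter erased. A $4^-$-power is a word of the form $XXXX^-$ with $X$ non-empty (equivalently, a word of period $p$ and length $4p-1$ for some $p\ge 1$). A (finite or infinite) binary word is faux-bonacci (fb) if it contains no factor $11$ and no factor that is a $4^-$-power. *)

theory Defs
  imports "HOL-Library.Stream" "HOL-Library.Z2"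
begin

text \<open>
  Finite binary words are of type \<^typ>\<open>bit list\<close>, binary \<open>\<omega>\<close>-words of type
  \<^typ>\<open>bit stream\<close>; \<^term>\<open>x @- w\<close> is the concatenation of a finite word with an \<open>\<omega>\<close>-word.
\<close>

definition factor :: "'a list \<Rightarrow> 'a stream \<Rightarrow> bool" where
  "factor x w \<longleftrightarrow> (\<exists>u v. w = u @- x @- v)"

definition four_minus_power :: "'a list \<Rightarrow> bool" where
  "four_minus_power y \<longleftrightarrow> (\<exists>X. X \<noteq> [] \<and> y = X @ X @ X @ butlast X)"

definition faux_bonacci :: "bit stream \<Rightarrow> bool" where
  "faux_bonacci w \<longleftrightarrow> \<not> factor [1, 1] w \<and> (\<forall>y. four_minus_power y \<longrightarrow> \<not> factor y w)"

definition fib_letter :: "bit \<Rightarrow> bit list" where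
  "fib_letter a = (if a = 0 then [0, 1] else [0])"

text \<open>
  \<^const>\<open>flat\<close> is the concatenation of a sequence of words only if all of them are non-empty,
  as the images of letters are here.
\<close>

definition fib_morphism :: "bit stream \<Rightarrow> bit stream" where
  "fib_morphism u = flat (smap fib_letter u)"

lemma fib_morphism_simps:
  "fib_morphism (0 ## u) = 0 ## 1 ## fib_morphism u"
  "fib_morphism (1 ## u) = 0 ## fib_morphism u"
  by (simp_all add: fib_morphism_def fib_letter_def)

end

theory Submission
  imports Defs
begin

text \<open>
  Since 11 does not occur in w, it parses uniquely into the blocks 01 and 0, up to a leading 1.
  Every block starts with 0, so an occurrence in u of X X X X\<open>\<^sup>-\<close> yields, with Y the image of X,
  an occurrence in the image of u of Y Y Y Z 0, where Z is the image of X\<open>\<^sup>-\<close>;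
  whatever the last letter of X, the word Z 0 has Y\<open>\<^sup>-\<close> as a prefix.
  Similarly 11 in u yields 000 in its image, which is itself a 4\<open>\<^sup>-\<close>-power.
\<close>

lemma bit_cases_zero_one:
  fixes b :: bit
  obtains "b = 0" | "b = 1"
  by (cases b) auto

lemma factor_shift: "factor x w \<Longrightarrow> factor x (u @- w)"
  unfolding factor_def by (metis shift_append)

lemma factor_SCons: "factor x w \<Longrightarrow> factor x (b ## w)"
  using factor_shift[of x w "[b]"] by simp

lemma factor_prefix: "factor (x @ y) w \<Longrightarrow> factor x w"
  unfolding factor_def by (metis shift_append)

definition fib_word :: "bit list \<Rightarrow> bit list" where
  "fib_word xs = concat (map fib_letter xs)"

lemma fib_word_append [simp]: "fib_word (xs @ ys) = fib_word xs @ fib_word ys"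
  by (simp add: fib_word_def)

lemma fib_word_eq_Nil_iff [simp]: "fib_word xs = [] \<longleftrightarrow> xs = []"
  by (cases xs) (auto simp: fib_word_def fib_letter_def)

lemma fib_morphism_shift: "fib_morphism (xs @- u) = fib_word xs @- fib_morphism u"
proof (induction xs)
  case (Cons a xs)
  then show ?case
    by (cases a rule: bit_cases_zero_one)
      (simp_all add: fib_morphism_simps fib_word_def fib_letter_def)
qed (simp add: fib_word_def)

lemma fib_morphism_eq_SCons: "\<exists>v. fib_morphism u = 0 ## v"
  by (cases u, cases "shd u" rule: bit_cases_zero_one) (auto simp: fib_morphism_simps)

text \<open>The extra 0 is the first letter of the block coming from the letter of \<open>u\<close>
  just after the occurrence of \<open>x\<close>.\<close>

lemma factor_fib_morphism: "factor x u \<Longrightarrow> factor (fib_word x @ [0]) (fib_morphism u)"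
proof -
  assume "factor x u"
  then obtain p v where "u = p @- x @- v"
    by (auto simp: factor_def)
  moreover obtain v' where "fib_morphism v = 0 ## v'"
    using fib_morphism_eq_SCons by blast
  ultimately have "fib_morphism u = fib_word p @- (fib_word x @ [0]) @- v'"
    by (simp add: fib_morphism_shift)
  then show ?thesis
    unfolding factor_def by blast
qed

text \<open>If the last letter is 0, its block 01 loses the 1 and \<open>r\<close> is empty; if it
  is 1, its block 0 disappears and \<open>r\<close> is that 0.\<close>

lemma butlast_fib_word_prefix:
  assumes "xs \<noteq> []"
  shows "\<exists>r. fib_word (butlast xs) @ [0] = butlast (fib_word xs) @ r"
proof -
  obtain ys c where "xs = ys @ [c]"
    using assms by (cases xs rule: rev_cases) auto
  then show ?thesis
    by (cases c rule: bit_cases_zero_one) (auto simp: fib_word_def fib_letter_def butlast_append)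
qed

lemma faux_bonacci_fib_morphismD:
  assumes fb: "faux_bonacci (fib_morphism u)"
  shows "faux_bonacci u"
  unfolding faux_bonacci_def
proof (intro conjI allI impI notI)
  assume "factor [1, 1] u"
  then have "factor [0, 0, 0] (fib_morphism u)"
    using factor_fib_morphism by (fastforce simp: fib_word_def fib_letter_def)
  moreover have "four_minus_power [0, 0, 0 :: bit]"
    \<comment> \<open>With a one-letter \<open>X\<close>, \<open>butlast X\<close> is empty, so only
      the cube remains.\<close>
    unfolding four_minus_power_def by (rule exI[of _ "[0]"]) simp
  ultimately show False
    using fb by (auto simp: faux_bonacci_def)
next
  fix y assume y: "four_minus_power y" "factor y u"
  then obtain X where X: "X \<noteq> []" "y = X @ X @ X @ butlast X"
    by (auto simp: four_minus_power_def)
  let ?Y = "fib_word X"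
  let ?z = "?Y @ ?Y @ ?Y @ butlast ?Y"
  obtain r where "fib_word (butlast X) @ [0] = butlast ?Y @ r"
    using butlast_fib_word_prefix[OF X(1)] by blast
  then have "fib_word y @ [0] = ?z @ r"
    by (simp add: X)
  then have "factor ?z (fib_morphism u)"
    using factor_fib_morphism[OF y(2)] by (metis factor_prefix)
  moreover have "four_minus_power ?z"
    unfolding four_minus_power_def using X(1) by (intro exI[of _ ?Y]) simp
  ultimately show False
    using fb by (auto simp: faux_bonacci_def)
qed

text \<open>Inverse parsing: the first letter is taken to be a 0 and never inspected; the second
  decides whether the first block is 01 or 0. Outside words over these blocks the result is
  meaningless.\<close>

primcorec fib_decode :: "bit stream \<Rightarrow> bit stream" where
  "shd (fib_decode w) = (if shd (stl w) = 1 then 0 else 1)"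
| "stl (fib_decode w) = fib_decode (if shd (stl w) = 1 then stl (stl w) else stl w)"

lemma fib_decode_simps:
  "fib_decode (a ## 1 ## w) = 0 ## fib_decode w"
  "fib_decode (a ## 0 ## w) = 1 ## fib_decode (0 ## w)"
  by (subst fib_decode.code, simp)+

text \<open>Removing the first block leaves a word that again starts with 0 and avoids 11. A block
  has length 1 or 2, so position \<open>n\<close> drops by 1 or 2, whence the strong induction with
  \<open>w\<close> arbitrary.\<close>

lemma fib_morphism_fib_decode_snth:
  assumes "\<not> factor [1, 1] (0 ## w)"
  shows "fib_morphism (fib_decode (0 ## w)) !! n = (0 ## w) !! n"
  using assms
proof (induction n arbitrary: w rule: less_induct)
  case (less n)
  obtain b v where w: "w = b ## v"
    by (cases w)
  show ?case
  proof (cases b rule: bit_cases_zero_one)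
    case 1
    have "\<not> factor [1, 1] (0 ## v)"
      using less.prems factor_SCons[of _ "0 ## v" 0] unfolding w 1 by blast
    then show ?thesis
      using less.IH by (cases n) (auto simp: w 1 fib_decode_simps fib_morphism_simps)
  next
    case 2
    obtain c v' where v: "v = c ## v'"
      by (cases v)
    have "c \<noteq> 1"
    proof
      assume "c = 1"
      then have "factor [1, 1] (0 ## w)"
        unfolding factor_def by (intro exI[of _ "[0]"] exI[of _ v']) (simp add: w v 2)
      then show False
        using less.prems by contradiction
    qed
    then have c: "c = 0"
      by (cases c rule: bit_cases_zero_one) auto
    have "\<not> factor [1, 1] (0 ## v')"
      using less.prems factor_shift[of _ "0 ## v'" "[0, 1]"] by (auto simp: w v 2 c)
    then have IH: "fib_morphism (fib_decode (0 ## v')) !! m = (0 ## v') !! m" if "m < n" for m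
      using less.IH that by blast
    \<comment> \<open>Positions 0 and 1 lie inside the block 01; position \<open>m + 2\<close> is
      position \<open>m\<close> of the rest.\<close>
    consider "n = 0" | "n = 1" | m where "n = Suc (Suc m)"
      by (metis One_nat_def not0_implies_Suc)
    then show ?thesis
      using IH by cases (auto simp: w v 2 c fib_decode_simps fib_morphism_simps)
  qed
qed

lemma ex_fib_morphism_eq:
  assumes "\<not> factor [1, 1] (0 ## w)"
  shows "\<exists>u. 0 ## w = fib_morphism u"
proof -
  have "fib_morphism (fib_decode (0 ## w)) = 0 ## w"
    \<comment> \<open>At \<open>id\<close>, \<open>smap_alt\<close> is extensionality of streams:
      agreement at every position gives equality.\<close>
    using fib_morphism_fib_decode_snth[OF assms] smap_alt[of id] by (metis id_apply stream.map_id)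
  then show ?thesis
    by metis
qed

theorem theorem5:
  fixes w :: "bit stream"
  assumes "faux_bonacci w"
  shows "\<exists>u a. faux_bonacci u \<and> a \<in> {[], [1]} \<and> w = a @- fib_morphism u"
proof -
  have no11: "\<not> factor [1, 1] w"
    using assms by (simp add: faux_bonacci_def)
  \<comment> \<open>A leading 1, if any, becomes \<open>a\<close>; the letter after it is 0 since 11
    is excluded, so the rest starts at a block boundary.\<close>
  obtain a v where a: "a \<in> {[], [1]}" and w: "w = a @- (0 ## v)"
  proof -
    obtain b c v where bcv: "w = b ## c ## v"
      by (metis stream.collapse)
    show thesis
    proof (cases b rule: bit_cases_zero_one)
      case 1
      then show thesis
        using that[of "[]" "c ## v"] bcv by simp
    next
      case 2
      have "c \<noteq> 1"
      proof
        assume "c = 1"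
        then have "factor [1, 1] w"
          unfolding factor_def by (intro exI[of _ "[]"] exI[of _ v]) (simp add: bcv 2)
        then show False
          using no11 by contradiction
      qed
      then have "c = 0"
        by (cases c rule: bit_cases_zero_one) auto
      then show thesis
        using that[of "[1]" v] bcv 2 by simp
    qed
  qed
  have "\<not> factor [1, 1] (0 ## v)"
    using no11 factor_shift unfolding w by blast
  then obtain u where u: "0 ## v = fib_morphism u"
    using ex_fib_morphism_eq by blast
  have "faux_bonacci (fib_morphism u)"
    using assms factor_shift unfolding faux_bonacci_def w u by blast
  then have "faux_bonacci u"
    by (rule faux_bonacci_fib_morphismD)
  then show ?thesis
    using a w u by auto
qed

end
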